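(* Let $A$ be a $B_1$-algebra and let $\mathcal{P}\in MinPr(A)\cup MinPr_s(A)$. Then each nonzero element of $\mathcal{P}$ is a zero-divisor in $A$.
   Context: A $B_1$-algebra (characteristic one semiring) is a commutative semiring $A$ with $0$ (neutral for addition and absorbing for multiplication) and $1$, such that $1+1=1$ (hence $x+x=x$ for all $x\in A$). An ideal of $A$ is a subset containing $0$, closed under addition, and closed under multiplication by elements of $A$. The saturation of an ideal $I$ is $\overline{I}=\{x\in A\mid \exists y\in I,\ x+y=y\}$, which is an ideal; $I$ is saturated if $I=\overline{I}$. An ideal $\mathcal{P}$ is prime if $\mathcal{P}\neq A$ and $xy\in\mathcal{P}$ implies $x\in\mathcal{P}$ or $y\in\mathcal{P}$. $Pr(A)$ is the set of prime ideals of $A$ and $Pr_s(A)$ the set of saturated prime ideals; $MinPr(A)$ and $MinPr_s(A)$ are the sets of minimal elements, for inclusion, of $Pr(A)$ and $Pr_s(A)$ respectively. A zero-divisor in $A$ is an element $a\in A\setminus\{0\}$ such that $ab=0$ for some $b\in A\setminus\{0\}$. *)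

theory Defs
  imports Main
begin

text \<open>
  The library class \<open>comm_semiring_1\<close> is not used as the base because it includes the
  axiom \<open>0 \<noteq> 1\<close>, which is not part of the definition of a \<open>B\<^sub>1\<close>-algebra.
\<close>

class b1_algebra = comm_semiring_0 + comm_monoid_mult +
  assumes one_add_one_eq_one: "1 + 1 = 1"

lemma b1_add_idem: "x + x = (x :: 'a :: b1_algebra)"
  by (metis distrib_left mult_1_right one_add_one_eq_one)

definition semiring_ideal :: "'a::b1_algebra set \<Rightarrow> bool" where
  "semiring_ideal I \<longleftrightarrow>
     0 \<in> I \<and> (\<forall>x\<in>I. \<forall>y\<in>I. x + y \<in> I) \<and> (\<forall>a. \<forall>x\<in>I. a * x \<in> I)"

definition saturation :: "'a::b1_algebra set \<Rightarrow> 'a set" where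
  "saturation I = {x. \<exists>y\<in>I. x + y = y}"

definition saturated :: "'a::b1_algebra set \<Rightarrow> bool" where
  "saturated I \<longleftrightarrow> I = saturation I"

definition prime_semiring_ideal :: "'a::b1_algebra set \<Rightarrow> bool" where
  "prime_semiring_ideal P \<longleftrightarrow>
     semiring_ideal P \<and> P \<noteq> UNIV \<and> (\<forall>x y. x * y \<in> P \<longrightarrow> x \<in> P \<or> y \<in> P)"

definition Pr :: "'a::b1_algebra set set" where
  "Pr = {P. prime_semiring_ideal P}"

definition Pr_s :: "'a::b1_algebra set set" where
  "Pr_s = {P \<in> Pr. saturated P}"

definition minimal_members :: "'a set set \<Rightarrow> 'a set set" where
  "minimal_members F = {P \<in> F. \<forall>Q\<in>F. Q \<subseteq> P \<longrightarrow> Q = P}"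

definition MinPr :: "'a::b1_algebra set set" where
  "MinPr = minimal_members Pr"

definition MinPr_s :: "'a::b1_algebra set set" where
  "MinPr_s = minimal_members Pr_s"

definition zero_divisor :: "'a::b1_algebra \<Rightarrow> bool" where
  "zero_divisor a \<longleftrightarrow> a \<noteq> 0 \<and> (\<exists>b. b \<noteq> 0 \<and> a * b = 0)"

end

theory Submission
  imports Defs
begin

text \<open>
  Write \<open>x \<le> y\<close> for \<open>x + y = y\<close>. An ideal maximal among the saturated ideals disjoint from a
  multiplicative set \<open>S\<close> is prime. If \<open>a \<in> P\<close> satisfies \<open>a b = 0 \<Longrightarrow> b = 0\<close>, then
  \<open>S = {a\<^sup>n s | s \<notin> P}\<close> is multiplicative and avoids \<open>0\<close>, and \<open>{0}\<close> is a saturated ideal, so there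
  is a saturated prime \<open>Q\<close> disjoint from \<open>S\<close>. It lies properly inside \<open>P\<close>, as \<open>a \<notin> Q\<close>, which
  contradicts minimality of \<open>P\<close> both among all primes and among the saturated ones.
\<close>

text \<open>Since \<open>x + x = x\<close>, every set lies in its saturation, so only the reverse
  inclusion carries content.\<close>

lemma saturated_iff_downward_closed:
  fixes I :: "'a::b1_algebra set"
  shows "saturated I \<longleftrightarrow> (\<forall>x. \<forall>y\<in>I. x + y = y \<longrightarrow> x \<in> I)"
  unfolding saturated_def saturation_def using b1_add_idem by blast

lemma subset_saturation: "I \<subseteq> saturation (I :: 'a::b1_algebra set)"
  unfolding saturation_def using b1_add_idem by blast

lemma semiring_ideal_saturation:
  fixes I :: "'a::b1_algebra set"
  assumes "semiring_ideal I"
  shows "semiring_ideal (saturation I)"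
  unfolding semiring_ideal_def
proof (intro conjI ballI allI)
  show "0 \<in> saturation I"
    using assms subset_saturation unfolding semiring_ideal_def by blast
next
  fix x y assume "x \<in> saturation I" "y \<in> saturation I"
  then obtain u v where "u \<in> I" "x + u = u" "v \<in> I" "y + v = v"
    unfolding saturation_def by blast
  moreover from this have "x + y + (u + v) = u + v"
    by (metis add.assoc add.left_commute)
  ultimately show "x + y \<in> saturation I"
    using assms unfolding semiring_ideal_def saturation_def by blast
next
  fix a x assume "x \<in> saturation I"
  then obtain u where "u \<in> I" "x + u = u"
    unfolding saturation_def by blast
  moreover from this have "a * x + a * u = a * u"
    by (metis distrib_left)
  ultimately show "a * x \<in> saturation I"
    using assms unfolding semiring_ideal_def saturation_def by blast
qed

text \<open>Transitivity of the order: if \<open>x + y = y\<close> and \<open>y + z = z\<close>,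
  then \<open>x + z = z\<close> by associativity.\<close>

lemma saturated_saturation:
  fixes I :: "'a::b1_algebra set"
  shows "saturated (saturation I)"
  unfolding saturated_iff_downward_closed saturation_def
  by (auto, metis add.assoc)

lemma saturated_zero: "saturated {0 :: 'a::b1_algebra}"
  unfolding saturated_iff_downward_closed by simp

lemma semiring_ideal_zero: "semiring_ideal {0 :: 'a::b1_algebra}"
  unfolding semiring_ideal_def by simp

text \<open>This is the ideal generated by \<open>Q\<close> and \<open>x\<close>; its saturation is
  what gets compared with a maximal \<open>Q\<close>.\<close>

lemma semiring_ideal_adjoin:
  fixes Q :: "'a::b1_algebra set"
  assumes "semiring_ideal Q"
  shows "semiring_ideal {q + r * x | q r. q \<in> Q}"
  unfolding semiring_ideal_def
proof (intro conjI ballI allI)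
  have "0 = 0 + 0 * x" by simp
  then show "0 \<in> {q + r * x | q r. q \<in> Q}"
    using assms unfolding semiring_ideal_def by blast
next
  fix u v assume "u \<in> {q + r * x | q r. q \<in> Q}" "v \<in> {q + r * x | q r. q \<in> Q}"
  then obtain q r q' r' where "q \<in> Q" "q' \<in> Q" "u = q + r * x" "v = q' + r' * x"
    by blast
  moreover from this have "u + v = (q + q') + (r + r') * x"
    by (simp add: distrib_left distrib_right ac_simps)
  ultimately show "u + v \<in> {q + r * x | q r. q \<in> Q}"
    using assms unfolding semiring_ideal_def by blast
next
  fix a u assume "u \<in> {q + r * x | q r. q \<in> Q}"
  then obtain q r where "q \<in> Q" "u = q + r * x" by blast
  moreover from this have "a * u = a * q + (a * r) * x"
    by (simp add: distrib_left ac_simps)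
  ultimately show "a * u \<in> {q + r * x | q r. q \<in> Q}"
    using assms unfolding semiring_ideal_def by blast
qed

lemma saturated_prime_disjoint:
  fixes S :: "'a::b1_algebra set"
  assumes one: "1 \<in> S" and mult: "\<And>s t. s \<in> S \<Longrightarrow> t \<in> S \<Longrightarrow> s * t \<in> S" and zero: "0 \<notin> S"
  obtains Q where "prime_semiring_ideal Q" "saturated Q" "Q \<inter> S = {}"
proof -
  define F where "F = {I. semiring_ideal I \<and> saturated I \<and> I \<inter> S = {}}"
  have "{0} \<in> F"
    using zero semiring_ideal_zero saturated_zero unfolding F_def by blast
  \<comment> \<open>The empty chain is excluded because its union misses \<open>0\<close>; the
    member \<open>{0}\<close> makes the nonempty form of Zorn's lemma applicable.\<close>
  moreover have "\<Union> C \<in> F" if "C \<noteq> {}" "subset.chain F C" for C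
  proof -
    have C: "I \<in> F" if "I \<in> C" for I
      using that \<open>subset.chain F C\<close> unfolding subset_chain_def by blast
    have "x + y \<in> \<Union> C" if xy: "x \<in> \<Union> C" "y \<in> \<Union> C" for x y
    proof -
      obtain I J where "I \<in> C" "J \<in> C" "x \<in> I" "y \<in> J"
        using xy by blast
      moreover from this have "I \<subseteq> J \<or> J \<subseteq> I"
        using \<open>subset.chain F C\<close> unfolding subset_chain_def by blast
      ultimately obtain K where "K \<in> C" "x \<in> K" "y \<in> K"
        by blast
      then show ?thesis
        using C[of K] unfolding F_def semiring_ideal_def by blast
    qed
    moreover have ideals: "semiring_ideal I" if "I \<in> C" for I
      using C[OF that] unfolding F_def by blast
    then have "0 \<in> \<Union> C"
      using \<open>C \<noteq> {}\<close> unfolding semiring_ideal_def by blast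
    moreover have "r * x \<in> \<Union> C" if "x \<in> \<Union> C" for r x
      using that ideals unfolding semiring_ideal_def by blast
    ultimately have "semiring_ideal (\<Union> C)"
      unfolding semiring_ideal_def by simp
    moreover have "saturated (\<Union> C)"
      using C unfolding F_def saturated_iff_downward_closed by fast
    ultimately show ?thesis
      using C unfolding F_def by blast
  qed
  ultimately obtain Q where Q: "Q \<in> F" and max: "\<And>I. I \<in> F \<Longrightarrow> Q \<subseteq> I \<Longrightarrow> I = Q"
    using subset_Zorn_nonempty[of F] by (metis empty_iff)
  have ideal: "semiring_ideal Q" and sat: "saturated Q" and disj: "Q \<inter> S = {}"
    using Q unfolding F_def by auto
  \<comment> \<open>The saturation of the ideal generated by \<open>Q\<close> and \<open>x\<close>
    is strictly larger than \<open>Q\<close>, so by maximality it must meet \<open>S\<close>: some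
    \<open>s\<close> in \<open>S\<close> lies below an element \<open>q + r * x\<close>.\<close>
  have meets: "\<exists>s\<in>S. \<exists>q\<in>Q. \<exists>r. s + (q + r * x) = q + r * x" if "x \<notin> Q" for x
  proof -
    define J where "J = {q + r * x | q r. q \<in> Q}"
    have "q = q + 0 * x" for q by simp
    then have "Q \<subseteq> J" unfolding J_def by blast
    have "x = 0 + 1 * x" by simp
    then have "x \<in> J"
      using ideal unfolding J_def semiring_ideal_def by blast
    have "saturation J \<notin> F"
      using max[of "saturation J"] \<open>Q \<subseteq> J\<close> \<open>x \<in> J\<close> \<open>x \<notin> Q\<close> subset_saturation[of J] by blast
    moreover have "semiring_ideal (saturation J)"
      unfolding J_def by (intro semiring_ideal_saturation semiring_ideal_adjoin ideal)
    ultimately obtain s where "s \<in> S" "s \<in> saturation J"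
      using saturated_saturation[of J] unfolding F_def by blast
    then show ?thesis
      unfolding saturation_def J_def by blast
  qed
  have "x \<in> Q \<or> y \<in> Q" if xy: "x * y \<in> Q" for x y
  proof (rule ccontr)
    assume "\<not> (x \<in> Q \<or> y \<in> Q)"
    then obtain s q r t p u where
      s: "s \<in> S" "q \<in> Q" "s + (q + r * x) = q + r * x" and
      t: "t \<in> S" "p \<in> Q" "t + (p + u * y) = p + u * y"
      using meets[of x] meets[of y] by blast
    \<comment> \<open>The product of the two upper bounds. Each term of its expansion has a factor
      \<open>q\<close>, \<open>p\<close> or \<open>x * y\<close>, all in \<open>Q\<close>.\<close>
    let ?w = "(q + r * x) * (p + u * y)"
    have "?w = (p + u * y) * q + ((r * x) * p + (r * u) * (x * y))"
      by (simp add: distrib_left distrib_right ac_simps)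
    then have w: "?w \<in> Q"
      using ideal s(2) t(2) xy unfolding semiring_ideal_def by metis
    \<comment> \<open>Multiplication is monotone, so \<open>s * t\<close> lies below
      \<open>s * (p + u * y)\<close>, which lies below \<open>?w\<close>; saturation then pulls
      \<open>s * t\<close> into \<open>Q\<close>.\<close>
    have "s * t + s * (p + u * y) = s * (p + u * y)"
      by (metis t(3) distrib_left)
    moreover have "s * (p + u * y) + ?w = ?w"
      by (metis s(3) distrib_right)
    ultimately have "s * t + ?w = ?w"
      by (metis add.assoc)
    then have "s * t \<in> Q"
      using sat w unfolding saturated_iff_downward_closed by blast
    then show False
      using mult[OF s(1) t(1)] disj by blast
  qed
  moreover have "Q \<noteq> UNIV"
    using one disj by blast
  ultimately have "prime_semiring_ideal Q"
    using ideal unfolding prime_semiring_ideal_def by blast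
  then show ?thesis
    using that sat disj by blast
qed

lemma one_notin_prime:
  fixes P :: "'a::b1_algebra set"
  assumes "prime_semiring_ideal P"
  shows "1 \<notin> P"
proof
  assume "1 \<in> P"
  then have "x * 1 \<in> P" for x
    using assms unfolding prime_semiring_ideal_def semiring_ideal_def by blast
  then show False
    using assms unfolding prime_semiring_ideal_def by auto
qed

text \<open>Being disjoint from \<open>S\<close> gives both conclusions: \<open>S\<close> contains
  the complement of \<open>P\<close>, whence \<open>Q \<subseteq> P\<close>, and it contains
  \<open>a\<close>.\<close>

lemma smaller_saturated_prime:
  fixes P :: "'a::b1_algebra set"
  assumes P: "prime_semiring_ideal P" and a: "\<And>b. a * b = 0 \<Longrightarrow> b = 0"
  obtains Q where "prime_semiring_ideal Q" "saturated Q" "Q \<subseteq> P" "a \<notin> Q"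
proof -
  \<comment> \<open>The multiplicative set generated by \<open>a\<close> and the complement of
    \<open>P\<close>, which is itself multiplicative because \<open>P\<close> is prime.\<close>
  define S where "S = {a ^ n * s | n s. s \<notin> P}"
  have one: "1 \<notin> P"
    using P by (rule one_notin_prime)
  have "1 = a ^ 0 * 1" "a = a ^ 1 * 1" by simp_all
  then have "1 \<in> S" "a \<in> S"
    using one unfolding S_def by blast+
  have outside: "s \<in> S" if "s \<notin> P" for s
  proof -
    have "s = a ^ 0 * s" by simp
    then show ?thesis using that unfolding S_def by blast
  qed
  have "u * v \<in> S" if "u \<in> S" "v \<in> S" for u v
  proof -
    obtain m s n t where "u = a ^ m * s" "v = a ^ n * t" "s \<notin> P" "t \<notin> P"
      using \<open>u \<in> S\<close> \<open>v \<in> S\<close> unfolding S_def by blast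
    moreover from this have "u * v = a ^ (m + n) * (s * t)"
      by (simp add: power_add ac_simps)
    moreover have "s * t \<notin> P"
      using P \<open>s \<notin> P\<close> \<open>t \<notin> P\<close> unfolding prime_semiring_ideal_def by blast
    ultimately show ?thesis unfolding S_def by blast
  qed
  moreover have "0 \<notin> S"
  proof
    assume "0 \<in> S"
    then obtain n s where "a ^ n * s = 0" "s \<notin> P"
      unfolding S_def by auto
    \<comment> \<open>The hypothesis on \<open>a\<close> cancels the factors of \<open>a ^ n\<close>
      one at a time; then \<open>s = 0\<close> would lie in \<open>P\<close>.\<close>
    have "s = 0" if "a ^ n * s = 0" for n
      using that by (induction n) (auto simp: mult.assoc dest: a)
    then show False
      using \<open>a ^ n * s = 0\<close> \<open>s \<notin> P\<close> P
      unfolding prime_semiring_ideal_def semiring_ideal_def by blast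
  qed
  ultimately obtain Q where "prime_semiring_ideal Q" "saturated Q" "Q \<inter> S = {}"
    using saturated_prime_disjoint[of S] \<open>1 \<in> S\<close> by metis
  then show ?thesis
    using that[of Q] outside \<open>a \<in> S\<close> by blast
qed

theorem theorem3p1:
  fixes P :: "'a::b1_algebra set"
  assumes "P \<in> MinPr \<union> MinPr_s"
  shows "\<forall>a\<in>P. a \<noteq> 0 \<longrightarrow> zero_divisor a"
proof (intro ballI impI)
  fix a assume "a \<in> P" "a \<noteq> 0"
  have P: "prime_semiring_ideal P"
    using assms unfolding MinPr_def MinPr_s_def minimal_members_def Pr_s_def Pr_def by blast
  show "zero_divisor a"
  proof (rule ccontr)
    assume "\<not> zero_divisor a"
    then have "b = 0" if "a * b = 0" for b
      using that \<open>a \<noteq> 0\<close> unfolding zero_divisor_def by blast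
    then obtain Q where "prime_semiring_ideal Q" "saturated Q" "Q \<subseteq> P" "a \<notin> Q"
      using smaller_saturated_prime[OF P] by metis
    \<comment> \<open>\<open>Q\<close> belongs to both \<open>Pr\<close> and \<open>Pr_s\<close>, so
      either kind of minimality of \<open>P\<close> applies.\<close>
    moreover from this have "Q = P"
      using assms unfolding MinPr_def MinPr_s_def minimal_members_def Pr_s_def Pr_def by blast
    ultimately show False
      using \<open>a \<in> P\<close> by blast
  qed
qed

end
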